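(* Let $k\ge2$ and let $\mathcal{G}$ and $\mathcal{F}$ be $k$-uniform hypergraphs such that $\mathcal{G}$ contains a copy of $H_3^{(k)}$. If there is a homomorphism from $\mathcal{G}$ to $\mathcal{F}$, then $ex_{\mathcal{F}}(n,\mathcal{G})=n^{k-o(1)}$. In particular, $ex_{K_t^{(k)}}(n,K_r^{(k)})=n^{k-o(1)}$ whenever $t\ge r>k$.
   Context: For $k$-uniform hypergraphs $\mathcal{F}$ and $\mathcal{G}$, consider $n$-vertex $k$-uniform hypergraphs $\mathcal{R}$ whose edge set is the union of pairwise edge-disjoint subhypergraphs each isomorphic to $\mathcal{F}$ (called $\mathcal{F}$-copies; each is thought of as a single colour). A subhypergraph of $\mathcal{R}$ is rainbow if its edges come from pairwise distinct $\mathcal{F}$-copies. $ex_{\mathcal{F}}(n,\mathcal{G})$ is the maximum number of $\mathcal{F}$-copies in such an $n$-vertex $\mathcal{R}$ with no rainbow copy of $\mathcal{G}$. $H_3^{(k)}$ (the $k$-uniform tight triangle) is the unique (up to isomorphism) $k$-uniform hypergraph on $k+1$ vertices with exactly $3$ edges. $K_t^{(k)}$ is the complete $k$-uniform hypergraph on $t$ vertices. A homomorphism from $\mathcal{G}$ to $\mathcal{F}$ is a map $\varphi:V(\mathcal{G})\to V(\mathcal{F})$ with $\varphi(e)\in E(\mathcal{F})$ for every $e\in E(\mathcal{G})$. The notation $f(n)=n^{k-o(1)}$ means $f(n)=n^{k-g(n)}$ for some function $g(n)\to0$ as $n\to\infty$. *)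

theory Defs
  imports Complex_Main
begin

datatype 'a hypergraph = Hypergraph (verts: "'a set") (edges: "'a set set")

definition uniform :: "nat \<Rightarrow> 'a hypergraph \<Rightarrow> bool" where
  "uniform k H \<longleftrightarrow> finite (verts H) \<and> (\<forall>e\<in>edges H. e \<subseteq> verts H \<and> card e = k)"

definition subhypergraph :: "'a hypergraph \<Rightarrow> 'a hypergraph \<Rightarrow> bool" where
  "subhypergraph H R \<longleftrightarrow> verts H \<subseteq> verts R \<and> edges H \<subseteq> edges R"

definition isomorphic :: "'a hypergraph \<Rightarrow> 'b hypergraph \<Rightarrow> bool" where
  "isomorphic H H' \<longleftrightarrow>
     (\<exists>f. bij_betw f (verts H) (verts H') \<and> edges H' = (\<lambda>e. f ` e) ` edges H)"

definition homomorphism :: "('a \<Rightarrow> 'b) \<Rightarrow> 'a hypergraph \<Rightarrow> 'b hypergraph \<Rightarrow> bool" where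
  "homomorphism \<phi> G F \<longleftrightarrow> \<phi> ` verts G \<subseteq> verts F \<and> (\<forall>e\<in>edges G. \<phi> ` e \<in> edges F)"

definition complete_hypergraph :: "nat \<Rightarrow> nat \<Rightarrow> nat hypergraph" where
  "complete_hypergraph k t = Hypergraph {..<t} {e. e \<subseteq> {..<t} \<and> card e = k}"

text \<open>The tight triangle is only determined up to isomorphism, so it is a predicate.\<close>

definition tight_triangle :: "nat \<Rightarrow> 'a hypergraph \<Rightarrow> bool" where
  "tight_triangle k T \<longleftrightarrow> uniform k T \<and> card (verts T) = k + 1 \<and> card (edges T) = 3"

text \<open>\<open>C\<close> is the set of colours of \<open>R\<close>, a colour being the \<open>F\<close>-copy itself.\<close>

definition copy_decomposition :: "'b hypergraph \<Rightarrow> 'a hypergraph \<Rightarrow> 'a hypergraph set \<Rightarrow> bool" where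
  "copy_decomposition F R C \<longleftrightarrow>
     (\<forall>c\<in>C. subhypergraph c R \<and> isomorphic F c) \<and>
     pairwise (\<lambda>c c'. disjnt (edges c) (edges c')) C \<and>
     edges R = (\<Union>c\<in>C. edges c)"

definition rainbow :: "'a hypergraph set \<Rightarrow> 'a hypergraph \<Rightarrow> bool" where
  "rainbow C H \<longleftrightarrow>
     (\<exists>col. inj_on col (edges H) \<and> (\<forall>e\<in>edges H. col e \<in> C \<and> e \<in> edges (col e)))"

definition has_rainbow_copy ::
    "'c hypergraph \<Rightarrow> 'a hypergraph \<Rightarrow> 'a hypergraph set \<Rightarrow> bool" where
  "has_rainbow_copy G R C \<longleftrightarrow>
     (\<exists>H. subhypergraph H R \<and> isomorphic G H \<and> rainbow C H)"

text \<open>The \<open>n\<close>-vertex hypergraphs are taken, up to isomorphism, on the vertex set \<open>{..<n}\<close>.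
  The set below is finite, and it is nonempty as soon as \<open>G\<close> has an edge (take \<open>C = {}\<close>).\<close>

definition ex_copies :: "'b hypergraph \<Rightarrow> nat \<Rightarrow> 'c hypergraph \<Rightarrow> nat" where
  "ex_copies F n G =
     Max {card C | (R :: nat hypergraph) C.
            verts R = {..<n} \<and> copy_decomposition F R C \<and> \<not> has_rainbow_copy G R C}"

text \<open>This is $f(n) = n^{k-o(1)}$. The equation is required for large \<open>n\<close> only, since
  \<open>f\<close> may vanish at small \<open>n\<close>.\<close>

definition power_minus_o1 :: "(nat \<Rightarrow> nat) \<Rightarrow> nat \<Rightarrow> bool" where
  "power_minus_o1 f k \<longleftrightarrow>
     (\<exists>g :: nat \<Rightarrow> real. g \<longlonglongrightarrow> 0 \<and>
        (\<forall>\<^sub>F n in sequentially. real (f n) = real n powr (real k - g n)))"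

end

theory Submission
  imports Defs "HOL-Computational_Algebra.Polynomial" "HOL-Library.FuncSet"
begin

text \<open>
  The upper bound is the trivial count of \<open>k\<close>-subsets, as colours are edge-disjoint and have edges.
  For the lower bound let \<open>F\<close> have \<open>t\<close> vertices and let a colour be a \<open>D\<close>-tuple of
  integer polynomials of degree less than \<open>k\<close> with coefficients in \<open>{0..<q}\<close>, placing the \<open>j\<close>-th
  vertex of \<open>F\<close> at \<open>(j, p(j))\<close>. Polynomials agreeing at \<open>k\<close> points coincide, so the copies are
  edge-disjoint. In a rainbow tight triangle three tuples agree pairwise at \<open>k - 1\<close> of \<open>k + 1\<close> points,
  which makes their vectors of leading coefficients three distinct collinear points of \<open>\<int>\<^sup>D\<close>. Requiring these
  vectors to lie on a common sphere (chosen by pigeonhole, as in Behrend's construction) excludes this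
  and costs only a factor \<open>D q\<^sup>2\<close>, that is \<open>n^(2/D)\<close> up to constants.
\<close>

subsection \<open>Interpolation and chords of spheres\<close>

text \<open>Subtracting the multiple of the monic product cancels the coefficient at
  \<open>m\<close>, so a nonzero difference would have degree below \<open>m\<close> but
  \<open>m\<close> roots. With a vanishing coefficient at \<open>m\<close> this becomes uniqueness
  of interpolation.\<close>

lemma poly_with_roots:
  fixes p :: "int poly" and J :: "nat set"
  assumes deg: "\<And>i. i > m \<Longrightarrow> coeff p i = 0" and J: "finite J" "card J = m"
    and roots: "\<And>j. j \<in> J \<Longrightarrow> poly p (int j) = 0"
  shows "p = smult (coeff p m) (\<Prod>j\<in>J. [:- int j, 1:])"
proof (rule ccontr)
  let ?Q = "\<Prod>j\<in>J. [:- int j, 1:]"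
  define s where "s = p - smult (coeff p m) ?Q"
  assume "\<not> ?thesis"
  then have "s \<noteq> 0" by (simp add: s_def)
  have "degree ?Q = m"
    using J by (subst degree_prod_eq_sum_degree) auto
  moreover have "lead_coeff ?Q = 1"
    by (simp add: lead_coeff_prod)
  ultimately have "coeff s i = 0" if "i \<ge> m" for i
    using that deg[of i] by (cases "i = m") (auto simp: s_def coeff_eq_0)
  then have "degree s < m"
    using \<open>s \<noteq> 0\<close> by (metis leading_coeff_0_iff not_le)
  have "m = card (int ` J)" using J by (simp add: card_image)
  also have "\<dots> \<le> card {x. poly s x = 0}"
  proof (rule card_mono)
    show "finite {x. poly s x = 0}" using \<open>s \<noteq> 0\<close> by (rule poly_roots_finite)
    have "poly ?Q (int j) = 0" if "j \<in> J" for j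
      using that J by (auto simp: poly_prod)
    then show "int ` J \<subseteq> {x. poly s x = 0}"
      using roots by (auto simp: s_def)
  qed
  also have "\<dots> \<le> degree s" using \<open>s \<noteq> 0\<close> by (rule card_poly_roots_bound)
  finally show False using \<open>degree s < m\<close> by simp
qed

text \<open>\<open>p1 - p3\<close> and \<open>p2 - p3\<close> are known up to a scalar from their
  roots, and they take the same value at \<open>a3\<close>, where \<open>p1\<close> and
  \<open>p2\<close> agree. The roots shared by both products contribute the factor \<open>Q\<close>,
  which cancels. The resulting ratio depends on the points alone, so it is the same for every
  coordinate of a tuple of polynomials.\<close>

lemma leading_coeffs_of_triangle:
  fixes p1 p2 p3 :: "int poly" and J :: "nat set"
  assumes deg: "\<And>i. i > m \<Longrightarrow> coeff p1 i = 0" "\<And>i. i > m \<Longrightarrow> coeff p2 i = 0" "\<And>i. i > m \<Longrightarrow> coeff p3 i = 0"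
    and J: "finite J" "card J = Suc (Suc m)" "a1 \<in> J" "a2 \<in> J" "a3 \<in> J"
      "a1 \<noteq> a2" "a1 \<noteq> a3" "a2 \<noteq> a3"
    and agree: "\<And>j. j \<in> J - {a1, a2} \<Longrightarrow> poly p1 (int j) = poly p2 (int j)"
      "\<And>j. j \<in> J - {a1, a3} \<Longrightarrow> poly p1 (int j) = poly p3 (int j)"
      "\<And>j. j \<in> J - {a2, a3} \<Longrightarrow> poly p2 (int j) = poly p3 (int j)"
  shows "(coeff p1 m - coeff p3 m) * (int a3 - int a2) = (coeff p2 m - coeff p3 m) * (int a3 - int a1)"
proof -
  define S where "S = J - {a1, a2, a3}"
  define Q where "Q = (\<Prod>j\<in>S. int a3 - int j)"
  have S: "finite S" "J - {a1, a3} = insert a2 S" "J - {a2, a3} = insert a1 S" "a1 \<notin> S" "a2 \<notin> S"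
    using J by (auto simp: S_def)
  have "Q \<noteq> 0" using S(1) by (auto simp: Q_def S_def)
  have cards: "card (insert a1 S) = m" "card (insert a2 S) = m"
    using J by (auto simp: S(2,3)[symmetric] card_Diff_subset)
  have "p1 - p3 = smult (coeff (p1 - p3) m) (\<Prod>j\<in>insert a2 S. [:- int j, 1:])"
    using cards S deg agree(2) by (intro poly_with_roots) auto
  moreover have "p2 - p3 = smult (coeff (p2 - p3) m) (\<Prod>j\<in>insert a1 S. [:- int j, 1:])"
    using cards S deg agree(3) by (intro poly_with_roots) auto
  moreover have "poly (p1 - p3) (int a3) = poly (p2 - p3) (int a3)"
    using agree(1)[of a3] J by simp
  ultimately have "poly (smult (coeff (p1 - p3) m) (\<Prod>j\<in>insert a2 S. [:- int j, 1:])) (int a3)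
      = poly (smult (coeff (p2 - p3) m) (\<Prod>j\<in>insert a1 S. [:- int j, 1:])) (int a3)"
    by metis
  then have "((coeff p1 m - coeff p3 m) * (int a3 - int a2)) * Q
      = ((coeff p2 m - coeff p3 m) * (int a3 - int a1)) * Q"
    using S by (simp add: poly_prod Q_def algebra_simps)
  then show ?thesis using \<open>Q \<noteq> 0\<close> by simp
qed

text \<open>A line through \<open>l3\<close> meets a sphere around the origin in at most one further
  point. The conditions on \<open>x\<close> and \<open>y\<close> exclude the degenerate solution in
  which \<open>l1\<close> and \<open>l2\<close> are that same point.\<close>

lemma proportional_chords_of_sphere:
  fixes l1 l2 l3 :: "'i \<Rightarrow> int"
  assumes "finite I"
    and chord: "\<And>d. d \<in> I \<Longrightarrow> (l1 d - l3 d) * x = (l2 d - l3 d) * y"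
    and "x \<noteq> 0" "x \<noteq> y"
    and "(\<Sum>d\<in>I. (l1 d)^2) = r" "(\<Sum>d\<in>I. (l2 d)^2) = r" "(\<Sum>d\<in>I. (l3 d)^2) = r"
    and "d \<in> I"
  shows "l1 d = l3 d"
proof -
  define U where "U = (\<Sum>d\<in>I. (l1 d - l3 d)^2)"
  define W where "W = (\<Sum>d\<in>I. l3 d * (l1 d - l3 d))"
  have expand: "(\<Sum>d\<in>I. (l d - l3 d)^2) + 2 * (\<Sum>d\<in>I. l3 d * (l d - l3 d))
      = (\<Sum>d\<in>I. (l d)^2) - (\<Sum>d\<in>I. (l3 d)^2)" for l
    unfolding sum_distrib_left sum.distrib[symmetric] sum_subtractf[symmetric]
    by (intro sum.cong) (auto simp: algebra_simps power2_eq_square)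
  have "U + 2 * W = 0" using expand[of l1] assms by (simp add: U_def W_def)
  \<comment> \<open>This is the sphere condition for \<open>l2\<close>, multiplied by y^2 and
    rewritten in terms of \<open>l1\<close> by the proportionality. Subtracting xy times the
    condition for \<open>l1\<close> leaves only \<open>U\<close>.\<close>
  moreover have "x^2 * U + 2 * y * x * W = 0"
  proof -
    have "x^2 * U = y^2 * (\<Sum>d\<in>I. (l2 d - l3 d)^2)"
      unfolding U_def sum_distrib_left
    proof (intro sum.cong refl)
      fix d assume "d \<in> I"
      then show "x^2 * (l1 d - l3 d)^2 = y^2 * (l2 d - l3 d)^2"
        using chord[of d] by algebra
    qed
    moreover have "x * W = y * (\<Sum>d\<in>I. l3 d * (l2 d - l3 d))"
      unfolding W_def sum_distrib_left
    proof (intro sum.cong refl)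
      fix d assume "d \<in> I"
      then show "x * (l3 d * (l1 d - l3 d)) = y * (l3 d * (l2 d - l3 d))"
        using chord[of d] by algebra
    qed
    ultimately have "x^2 * U + 2 * y * x * W
        = y^2 * ((\<Sum>d\<in>I. (l2 d - l3 d)^2) + 2 * (\<Sum>d\<in>I. l3 d * (l2 d - l3 d)))"
      by (simp add: algebra_simps power2_eq_square)
    then show ?thesis using expand[of l2] assms by simp
  qed
  ultimately have "x * (x - y) * U = 0" by algebra
  then have "U = 0" using assms by simp
  then show ?thesis using assms unfolding U_def by (subst (asm) sum_nonneg_eq_0_iff) auto
qed

subsection \<open>Rainbow-free packings\<close>

lemma card_eq_pred_subsetE:
  assumes "card e = k" "card W = Suc k" "e \<subseteq> W" "finite W"
  obtains x where "x \<in> W" "e = W - {x}"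
proof -
  have "card (W - e) = 1"
    using assms by (simp add: card_Diff_subset finite_subset)
  then obtain x where "W - e = {x}" by (meson card_1_singletonE)
  then have "x \<in> W" "e = W - {x}" using assms by auto
  then show ?thesis by (rule that)
qed

text \<open>Among \<open>k + 1\<close> points a \<open>k\<close>-set is the complement of one point,
  so the three edges amount to three distinct missing points.\<close>

lemma tight_triangle_image:
  assumes "tight_triangle k T" and "inj_on f (verts T)"
  obtains W x1 x2 x3 where "finite W" "card W = Suc k" "x1 \<in> W" "x2 \<in> W" "x3 \<in> W"
    "x1 \<noteq> x2" "x1 \<noteq> x3" "x2 \<noteq> x3"
    "W - {x1} \<in> (`) f ` edges T" "W - {x2} \<in> (`) f ` edges T" "W - {x3} \<in> (`) f ` edges T"
proof -
  define W where "W = f ` verts T"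
  have T: "finite (verts T)" "card (verts T) = Suc k" "card (edges T) = 3"
    "\<And>e. e \<in> edges T \<Longrightarrow> e \<subseteq> verts T \<and> card e = k"
    using assms(1) by (auto simp: tight_triangle_def uniform_def)
  have W: "finite W" "card W = Suc k"
    using T assms(2) by (auto simp: W_def card_image)
  obtain e1 e2 e3 where e: "edges T = {e1, e2, e3}" "e1 \<noteq> e2" "e1 \<noteq> e3" "e2 \<noteq> e3"
    using T(3) by (auto simp: card_3_iff)
  have missing: "\<exists>x\<in>W. f ` e = W - {x}" if "e \<in> edges T" for e
  proof -
    have "card (f ` e) = k" using T(4)[OF that] assms(2) by (metis card_image inj_on_subset)
    moreover have "f ` e \<subseteq> W" using T(4)[OF that] by (auto simp: W_def)
    ultimately show ?thesis using card_eq_pred_subsetE W by metis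
  qed
  obtain x1 where x1: "x1 \<in> W" "f ` e1 = W - {x1}" using missing[of e1] e(1) by blast
  obtain x2 where x2: "x2 \<in> W" "f ` e2 = W - {x2}" using missing[of e2] e(1) by blast
  obtain x3 where x3: "x3 \<in> W" "f ` e3 = W - {x3}" using missing[of e3] e(1) by blast
  have inj: "e = e'" if "f ` e = f ` e'" "e \<in> edges T" "e' \<in> edges T" for e e'
    using that T(4)[of e] T(4)[of e'] inj_on_image_eq_iff[OF assms(2)] by blast
  show ?thesis
  proof (rule that[OF W x1(1) x2(1) x3(1)])
    show "x1 \<noteq> x2" using inj[of e1 e2] x1(2) x2(2) e by force
    show "x1 \<noteq> x3" using inj[of e1 e3] x1(2) x3(2) e by force
    show "x2 \<noteq> x3" using inj[of e2 e3] x2(2) x3(2) e by force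
  qed (simp_all add: e(1) x1(2) x2(2) x3(2))
qed

text \<open>Choosing one edge from each colour is injective by edge-disjointness. The bound also
  yields the finiteness that makes \<open>Max\<close> in \<open>ex_copies\<close>
  meaningful.\<close>

lemma ex_copies_candidates_bounded:
  assumes F: "uniform k F" "edges F \<noteq> {}"
    and R: "verts R = {..<n}" "copy_decomposition F R C"
  shows "card C \<le> n choose k"
proof -
  have dec: "subhypergraph c R" "isomorphic F c" if "c \<in> C" for c
    using R(2) that by (auto simp: copy_decomposition_def)
  have c_edges: "edges c \<noteq> {} \<and> edges c \<subseteq> {e. e \<subseteq> {..<n} \<and> card e = k}" if c: "c \<in> C" for c
  proof -
    obtain f where f: "bij_betw f (verts F) (verts c)" "edges c = (`) f ` edges F"
      using dec(2)[OF c] by (auto simp: isomorphic_def)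
    have "f ` e \<subseteq> {..<n} \<and> card (f ` e) = k" if "e \<in> edges F" for e
    proof -
      have "e \<subseteq> verts F" "card e = k" using F that by (auto simp: uniform_def)
      moreover have "f ` verts F \<subseteq> {..<n}"
        using dec(1)[OF c] f R by (auto simp: bij_betw_def subhypergraph_def)
      ultimately show ?thesis
        using f by (metis bij_betw_def card_image image_mono inj_on_subset subset_trans)
    qed
    then show ?thesis using f F by auto
  qed
  define pick where "pick c = (SOME e. e \<in> edges c)" for c :: "nat hypergraph"
  have pick: "pick c \<in> edges c" if "c \<in> C" for c
    using c_edges[OF that] by (auto simp: pick_def some_in_eq)
  have "inj_on pick C"
  proof (rule inj_onI, rule ccontr)
    fix c c' assume "c \<in> C" "c' \<in> C" "pick c = pick c'" "c \<noteq> c'"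
    moreover from this have "disjnt (edges c) (edges c')"
      using R(2) by (auto simp: copy_decomposition_def pairwise_def)
    ultimately show False using pick by (metis disjnt_iff)
  qed
  moreover have "pick ` C \<subseteq> {e. e \<subseteq> {..<n} \<and> card e = k}"
    using pick c_edges by blast
  moreover have "finite {e. e \<subseteq> {..<n} \<and> card e = k}" by simp
  ultimately have "card C \<le> card {e. e \<subseteq> {..<n} \<and> card e = k}"
    by (rule card_inj_on_le)
  then show ?thesis by (simp add: n_subsets)
qed

lemma ex_copies_finite:
  assumes "uniform k F" "edges F \<noteq> {}"
  shows "finite {card C | (R :: nat hypergraph) C.
            verts R = {..<n} \<and> copy_decomposition F R C \<and> \<not> has_rainbow_copy G R C}"
  by (rule finite_subset[of _ "{..n choose k}"])
    (auto intro: ex_copies_candidates_bounded[OF assms])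

lemma ex_copies_ge:
  assumes "uniform k F" "edges F \<noteq> {}"
    and "verts R = {..<n}" "copy_decomposition F R C" "\<not> has_rainbow_copy G R C"
  shows "card C \<le> ex_copies F n G"
  unfolding ex_copies_def by (rule Max_ge[OF ex_copies_finite]) (use assms in auto)

lemma ex_copies_le:
  assumes F: "uniform k F" "edges F \<noteq> {}" and G: "edges G \<noteq> {}"
  shows "ex_copies F n G \<le> n ^ k"
proof -
  \<comment> \<open>The empty packing shows that the maximum is over a nonempty set.\<close>
  let ?R = "Hypergraph {..<n} {} :: nat hypergraph"
  have "copy_decomposition F ?R {}" by (simp add: copy_decomposition_def)
  moreover have "\<not> has_rainbow_copy G ?R {}"
    using G by (auto simp: has_rainbow_copy_def rainbow_def isomorphic_def)
  ultimately have "\<exists>(R :: nat hypergraph) C. verts R = {..<n} \<and> copy_decomposition F R C \<and>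
      \<not> has_rainbow_copy G R C"
    by (intro exI[of _ ?R] exI[of _ "{}"]) simp
  then have "ex_copies F n G \<le> n choose k"
    unfolding ex_copies_def
    by (subst Max_le_iff[OF ex_copies_finite[OF F]])
      (auto intro: ex_copies_candidates_bounded[OF F])
  also have "\<dots> \<le> n ^ k" by (cases "k \<le> n") (auto simp: binomial_le_pow binomial_eq_0)
  finally show ?thesis .
qed

text \<open>This separates the hypergraph argument from the algebra. \<open>part\<close> makes a
  vertex determine its part, \<open>agree\<close> gives edge-disjointness, and
  \<open>triangle\<close> rules out rainbow tight triangles, hence rainbow copies of
  \<open>G\<close>.\<close>

lemma ex_copies_ge_partite_family:
  fixes \<phi> :: "'p \<Rightarrow> nat \<Rightarrow> nat"
  assumes k: "k \<ge> 2"
    and F: "uniform k F" "edges F \<noteq> {}" and t: "t = card (verts F)"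
    and G: "subhypergraph T G" "tight_triangle k T"
    and range: "\<And>P j. P \<in> X \<Longrightarrow> j < t \<Longrightarrow> \<phi> P j < n"
    and part: "\<And>P P' j j'. P \<in> X \<Longrightarrow> P' \<in> X \<Longrightarrow> j < t \<Longrightarrow> j' < t \<Longrightarrow> \<phi> P j = \<phi> P' j' \<Longrightarrow> j = j'"
    and agree: "\<And>P P' J. P \<in> X \<Longrightarrow> P' \<in> X \<Longrightarrow> J \<subseteq> {..<t} \<Longrightarrow> card J = k \<Longrightarrow>
        (\<And>j. j \<in> J \<Longrightarrow> \<phi> P j = \<phi> P' j) \<Longrightarrow> P = P'"
    and triangle: "\<And>P1 P2 P3 J a1 a2 a3. P1 \<in> X \<Longrightarrow> P2 \<in> X \<Longrightarrow> P3 \<in> X \<Longrightarrow>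
        J \<subseteq> {..<t} \<Longrightarrow> card J = Suc k \<Longrightarrow> a1 \<in> J \<Longrightarrow> a2 \<in> J \<Longrightarrow> a3 \<in> J \<Longrightarrow>
        a1 \<noteq> a2 \<Longrightarrow> a1 \<noteq> a3 \<Longrightarrow> a2 \<noteq> a3 \<Longrightarrow>
        (\<And>j. j \<in> J - {a1, a2} \<Longrightarrow> \<phi> P1 j = \<phi> P2 j) \<Longrightarrow>
        (\<And>j. j \<in> J - {a1, a3} \<Longrightarrow> \<phi> P1 j = \<phi> P3 j) \<Longrightarrow>
        (\<And>j. j \<in> J - {a2, a3} \<Longrightarrow> \<phi> P2 j = \<phi> P3 j) \<Longrightarrow> P1 = P3"
  shows "card X \<le> ex_copies F n G"
proof -
  have finF: "finite (verts F)" and Fe: "\<And>e. e \<in> edges F \<Longrightarrow> e \<subseteq> verts F \<and> card e = k"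
    using F by (auto simp: uniform_def)
  obtain b where b: "bij_betw b (verts F) {..<t}"
    using finF t by (metis atLeast0LessThan ex_bij_betw_finite_nat)
  have b_less: "b v < t" if "v \<in> verts F" for v
    using b that by (auto simp: bij_betw_def)
  have b_inj: "b v = b v' \<Longrightarrow> v = v'" if "v \<in> verts F" "v' \<in> verts F" for v v'
    using b that by (auto simp: bij_betw_def inj_on_def)
  define c where "c P = Hypergraph ((\<lambda>v. \<phi> P (b v)) ` verts F)
      ((`) (\<lambda>v. \<phi> P (b v)) ` edges F)" for P
  have hinj: "inj_on (\<lambda>v. \<phi> P (b v)) (verts F)" if "P \<in> X" for P
    by (rule inj_onI) (rule b_inj, assumption, assumption, rule part[OF that that b_less b_less])
  have iso: "isomorphic F (c P)" if "P \<in> X" for P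
    unfolding isomorphic_def c_def
    by (rule exI[of _ "\<lambda>v. \<phi> P (b v)"]) (use hinj[OF that] in \<open>auto simp: bij_betw_def\<close>)
  have edge_c: "\<exists>j<t. w = \<phi> P j" if "e \<in> edges (c P)" "w \<in> e" for e w P
    using that Fe b_less by (fastforce simp: c_def)
  \<comment> \<open>A vertex of a shared edge lies in one part only, so both colours place that part
    there; hence they agree on the \<open>k\<close> parts met by the edge.\<close>
  have eq_if: "P = P'" if PP: "P \<in> X" "P' \<in> X" and e: "e \<in> edges (c P)" "e \<in> edges (c P')" for P P' e
  proof -
    obtain e1 where e1: "e1 \<in> edges F" "e = (\<lambda>v. \<phi> P (b v)) ` e1" using e by (auto simp: c_def)
    show ?thesis
    proof (rule agree[OF PP, of "b ` e1"])
      show "b ` e1 \<subseteq> {..<t}" using e1 Fe b_less by blast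
      show "card (b ` e1) = k" using e1 Fe b
        by (metis bij_betw_def card_image inj_on_subset)
      fix j assume "j \<in> b ` e1"
      then obtain v where "v \<in> e1" "j = b v" by blast
      then have j: "j < t" "\<phi> P j \<in> e" using e1 Fe[OF e1(1)] b_less by auto
      then obtain j' where "j' < t" "\<phi> P j = \<phi> P' j'" using edge_c e by blast
      moreover from this have "j = j'" using part[OF PP j(1)] by blast
      ultimately show "\<phi> P j = \<phi> P' j" by simp
    qed
  qed
  define C where "C = c ` X"
  define R where "R = Hypergraph {..<n} (\<Union>c\<in>C. edges c)"
  \<comment> \<open>Equal colours with an edge share that edge, so \<open>eq_if\<close> makes
    \<open>c\<close> injective and no colours are lost in counting.\<close>
  have ne: "edges (c P) \<noteq> {}" for P using F by (simp add: c_def)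
  have "inj_on c X"
  proof (rule inj_onI)
    fix P P' assume "P \<in> X" "P' \<in> X" "c P = c P'"
    then show "P = P'" using eq_if ne[of P] by (metis all_not_in_conv)
  qed
  then have cardC: "card C = card X" by (simp add: C_def card_image)
  have dec: "copy_decomposition F R C"
    unfolding copy_decomposition_def
  proof (intro conjI ballI)
    fix d assume "d \<in> C"
    then obtain P where P: "P \<in> X" "d = c P" by (auto simp: C_def)
    have "verts d \<subseteq> {..<n}" using range P b_less by (auto simp: c_def)
    then show "subhypergraph d R" using \<open>d \<in> C\<close> by (auto simp: subhypergraph_def R_def)
    show "isomorphic F d" using iso P by simp
  next
    show "pairwise (\<lambda>c c'. disjnt (edges c) (edges c')) C"
      unfolding pairwise_def C_def disjnt_iff using eq_if by blast
    show "edges R = (\<Union>c\<in>C. edges c)" by (simp add: R_def)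
  qed
  have "\<not> has_rainbow_copy G R C"
  proof
    assume "has_rainbow_copy G R C"
    then obtain H where H0: "isomorphic G H" "rainbow C H"
      by (auto simp: has_rainbow_copy_def)
    from H0(1) obtain f where H: "bij_betw f (verts G) (verts H)" "edges H = (`) f ` edges G"
      by (auto simp: isomorphic_def)
    from H0(2) obtain col where col: "inj_on col (edges H)"
      "\<forall>e\<in>edges H. col e \<in> C \<and> e \<in> edges (col e)"
      unfolding rainbow_def by blast
    have "inj_on f (verts T)"
      using H(1) G(1) by (auto simp: bij_betw_def subhypergraph_def intro: inj_on_subset)
    then obtain W x1 x2 x3 where W: "finite W" "card W = Suc k" "x1 \<in> W" "x2 \<in> W" "x3 \<in> W"
      and x: "x1 \<noteq> x2" "x1 \<noteq> x3" "x2 \<noteq> x3"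
      and WT: "W - {x1} \<in> (`) f ` edges T" "W - {x2} \<in> (`) f ` edges T" "W - {x3} \<in> (`) f ` edges T"
      using tight_triangle_image[OF G(2)] by metis
    have "(`) f ` edges T \<subseteq> edges H" using G(1) H(2) by (auto simp: subhypergraph_def)
    then have WH: "W - {x1} \<in> edges H" "W - {x2} \<in> edges H" "W - {x3} \<in> edges H"
      using WT by auto
    have colour: "\<exists>P\<in>X. col e = c P \<and> e \<in> edges (c P)" if "e \<in> edges H" for e
      using bspec[OF col(2) that] by (auto simp: C_def)
    obtain P1 where P1: "P1 \<in> X" "col (W - {x1}) = c P1" "W - {x1} \<in> edges (c P1)"
      using colour[OF WH(1)] by blast
    obtain P2 where P2: "P2 \<in> X" "col (W - {x2}) = c P2" "W - {x2} \<in> edges (c P2)"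
      using colour[OF WH(2)] by blast
    obtain P3 where P3: "P3 \<in> X" "col (W - {x3}) = c P3" "W - {x3} \<in> edges (c P3)"
      using colour[OF WH(3)] by blast
    have "W - {x1} \<noteq> W - {x3}" using W x by auto
    then have "P1 \<noteq> P3" using P1 P3 WH inj_onD[OF col(1)] by metis
    \<comment> \<open>A vertex differs from \<open>x1\<close> or from \<open>x2\<close>, so it lies
      in an edge of colour \<open>c P1\<close> or \<open>c P2\<close>.\<close>
    have in_part: "\<exists>j<t. \<exists>P\<in>X. w = \<phi> P j" if "w \<in> W" for w
      using that edge_c[OF P1(3), of w] edge_c[OF P2(3), of w] P1(1) P2(1) x(1) by auto
    then obtain i where i: "\<And>w. w \<in> W \<Longrightarrow> i w < t" "\<And>w. w \<in> W \<Longrightarrow> \<exists>P\<in>X. w = \<phi> P (i w)"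
      by metis
    have \<phi>_i: "\<phi> P (i w) = w" if P: "P \<in> X" "W - {x} \<in> edges (c P)" and w: "w \<in> W - {x}" for P w x
    proof -
      obtain j where "j < t" "w = \<phi> P j" using edge_c[OF P(2) w] by blast
      moreover obtain P' where "P' \<in> X" "w = \<phi> P' (i w)" using i(2)[of w] w by blast
      moreover have "i w < t" using w i(1) by blast
      ultimately have "j = i w" by (intro part[of P P' j "i w"] P(1)) simp_all
      then show ?thesis using \<open>w = \<phi> P j\<close> by simp
    qed
    note \<phi>1 = \<phi>_i[OF P1(1,3)] and \<phi>2 = \<phi>_i[OF P2(1,3)] and \<phi>3 = \<phi>_i[OF P3(1,3)]
    \<comment> \<open>Two vertices of \<open>W\<close> can meet at most two of the three missing
      points, so some edge of the triangle contains both, and one colour has a single vertex in each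
      part. Thus \<open>W\<close> meets \<open>k + 1\<close> different parts.\<close>
    have i_inj: "inj_on i W"
    proof (rule inj_onI)
      fix w w' assume w: "w \<in> W" "w' \<in> W" "i w = i w'"
      have "(w \<noteq> x1 \<and> w' \<noteq> x1) \<or> (w \<noteq> x2 \<and> w' \<noteq> x2) \<or> (w \<noteq> x3 \<and> w' \<noteq> x3)"
        using x by blast
      moreover have eq: "w = w'" if "\<phi> P (i w) = w" "\<phi> P (i w') = w'" for P
        by (rule trans[OF that(1)[symmetric]]) (simp only: w(3) that(2))
      ultimately show "w = w'"
      proof (elim disjE)
        assume "w \<noteq> x1 \<and> w' \<noteq> x1"
        then show ?thesis by (intro eq[of P1] \<phi>1) (use w(1,2) in auto)
      next
        assume "w \<noteq> x2 \<and> w' \<noteq> x2"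
        then show ?thesis by (intro eq[of P2] \<phi>2) (use w(1,2) in auto)
      next
        assume "w \<noteq> x3 \<and> w' \<noteq> x3"
        then show ?thesis by (intro eq[of P3] \<phi>3) (use w(1,2) in auto)
      qed
    qed
    have "P1 = P3"
    proof (rule triangle[OF P1(1) P2(1) P3(1), of "i ` W" "i x1" "i x2" "i x3"])
      show "card (i ` W) = Suc k" using W i_inj by (simp add: card_image)
      show "i ` W \<subseteq> {..<t}" using i(1) by auto
      show "i x1 \<noteq> i x2" "i x1 \<noteq> i x3" "i x2 \<noteq> i x3"
        using x W(3-5) by (simp_all add: inj_on_eq_iff[OF i_inj])
      have agree_off: "\<phi> P j = \<phi> P' j"
        if "\<And>w. w \<in> W - {x} \<Longrightarrow> \<phi> P (i w) = w" "\<And>w. w \<in> W - {x'} \<Longrightarrow> \<phi> P' (i w) = w"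
          and j: "j \<in> i ` W - {i x, i x'}" for P P' j x x'
      proof -
        obtain w where "w \<in> W" "j = i w" "w \<noteq> x" "w \<noteq> x'" using j by blast
        then show ?thesis using that(1)[of w] that(2)[of w] by simp
      qed
      show "\<phi> P1 j = \<phi> P2 j" if "j \<in> i ` W - {i x1, i x2}" for j
        by (rule agree_off[OF \<phi>1 \<phi>2 that])
      show "\<phi> P1 j = \<phi> P3 j" if "j \<in> i ` W - {i x1, i x3}" for j
        by (rule agree_off[OF \<phi>1 \<phi>3 that])
      show "\<phi> P2 j = \<phi> P3 j" if "j \<in> i ` W - {i x2, i x3}" for j
        by (rule agree_off[OF \<phi>2 \<phi>3 that])
    qed (use W(3-5) in auto)
    then show False using \<open>P1 \<noteq> P3\<close> by simp
  qed
  then have "card C \<le> ex_copies F n G"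
    by (intro ex_copies_ge[OF F _ dec]) (simp add: R_def)
  then show ?thesis by (simp add: cardC)
qed

subsection \<open>The polynomial construction\<close>

text \<open>A whole tuple of polynomials is kept in one function on index pairs, so that the tuples
  with bounded coefficients form a \<open>PiE\<close> and are easily counted.\<close>

definition param_poly :: "nat \<Rightarrow> (nat \<times> nat \<Rightarrow> int) \<Rightarrow> nat \<Rightarrow> int poly" where
  "param_poly k P d = (\<Sum>i<k. monom (P (d, i)) i)"

lemma coeff_param_poly: "coeff (param_poly k P d) i = (if i < k then P (d, i) else 0)"
  by (simp add: param_poly_def coeff_sum)

text \<open>Each of the \<open>k\<close> terms is below \<open>t ^ k * q\<close>. For fixed
  \<open>k\<close> and \<open>t\<close> the values thus range over O(q) integers, and each part
  needs only O(q^D) vertices when \<open>D\<close> is fixed too.\<close>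

lemma param_poly_bounds:
  assumes "\<And>i. i < k \<Longrightarrow> 0 \<le> P (d, i) \<and> P (d, i) < int q" and "j < t" "k > 0"
  shows "poly (param_poly k P d) (int j) \<in> {0..<int (k * t ^ k * q)}"
proof -
  have eq: "poly (param_poly k P d) (int j) = (\<Sum>i<k. P (d, i) * int j ^ i)"
    by (simp add: param_poly_def poly_sum poly_monom)
  have "P (d, i) * int j ^ i < int (t ^ k * q)" if "i < k" for i
  proof -
    have "int j ^ i \<le> int t ^ i" using assms by (intro power_mono) auto
    also have "\<dots> \<le> int t ^ k" using assms that by (intro power_increasing) auto
    finally have "P (d, i) * int j ^ i \<le> P (d, i) * int t ^ k"
      using assms(1)[OF that] by (intro mult_left_mono) auto
    also have "\<dots> < int q * int t ^ k"
      using assms that by (intro mult_strict_right_mono) auto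
    finally show ?thesis by (simp add: mult.commute)
  qed
  then have "(\<Sum>i<k. P (d, i) * int j ^ i) < of_nat (card {..<k}) * int (t ^ k * q)"
    using \<open>k > 0\<close> by (intro sum_bounded_above_strict) auto
  moreover have "(\<Sum>i<k. P (d, i) * int j ^ i) \<ge> 0"
    using assms by (intro sum_nonneg) auto
  ultimately show ?thesis by (simp add: eq mult.assoc)
qed

lemma ex_copies_polynomial_construction:
  assumes k: "k \<ge> 2"
    and F: "uniform k F" "edges F \<noteq> {}" and t: "t = card (verts F)"
    and G: "subhypergraph T G" "tight_triangle k T"
    and D: "D > 0" and q: "q > 0" and n: "t * (k * t ^ k * q) ^ D \<le> n"
  shows "q ^ (D * k) \<le> D * q ^ 2 * ex_copies F n G"
proof -
  define M where "M = k * t ^ k * q"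
  define X0 where "X0 = PiE ({..<D} \<times> {..<k}) (\<lambda>_. {0..<int q})"
  define V where "V = {..<t} \<times> PiE {..<D} (\<lambda>_. {0..<int M})"
  \<comment> \<open>The first component makes the parts disjoint; restricting the second to
    \<open>{..<D}\<close> puts it into the \<open>PiE\<close> of \<open>V\<close>.\<close>
  define \<psi> where "\<psi> P j = (j, \<lambda>d\<in>{..<D}. poly (param_poly k P d) (int j))" for P and j :: nat
  \<comment> \<open>The squared length of the vector of leading coefficients. It takes fewer than
    \<open>D * q ^ 2 + 1\<close> values, and \<open>X\<close> is a most frequent or at least
    average-sized fibre, obtained by pigeonhole.\<close>
  define N where "N P = nat (\<Sum>d<D. (P (d, k - 1))^2)" for P :: "nat \<times> nat \<Rightarrow> int"
  have X0: "finite X0" "card X0 = q ^ (D * k)"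
    by (auto simp: X0_def card_PiE finite_PiE)
  have P_bounds: "0 \<le> P (d, i) \<and> P (d, i) < int q" if "P \<in> X0" "d < D" "i < k" for P d i
    using that by (fastforce simp: X0_def)
  have N_less: "N P < D * q ^ 2" if "P \<in> X0" for P
  proof -
    have "(P (d, k - 1))^2 < int q ^ 2" if "d < D" for d
      using P_bounds[OF \<open>P \<in> X0\<close> that, of "k - 1"] k by (intro power_strict_mono) auto
    then have "(\<Sum>d<D. (P (d, k - 1))^2) < of_nat (card {..<D}) * int q ^ 2"
      using D by (intro sum_bounded_above_strict) auto
    then show ?thesis by (simp add: N_def nat_less_iff sum_nonneg)
  qed
  obtain r where r: "card X0 \<le> card (N -` {r} \<inter> X0) * card {..<D * q ^ 2}"
  proof -
    have "N \<in> X0 \<rightarrow> {..<D * q ^ 2}" "{..<D * q ^ 2} \<noteq> {}"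
      using N_less D q by (auto simp: lessThan_empty_iff)
    from pigeonhole_card[OF this(1) X0(1) _ this(2)] show ?thesis using that by blast
  qed
  define X where "X = N -` {r} \<inter> X0"
  have XX0: "P \<in> X0" if "P \<in> X" for P using that by (simp add: X_def)
  have sphere: "(\<Sum>d<D. (P (d, k - 1))^2) = int r" if "P \<in> X" for P
  proof -
    have "nat (\<Sum>d<D. (P (d, k - 1))^2) = r" using that by (simp add: X_def N_def)
    then show ?thesis by (metis nat_0_le sum_nonneg zero_le_power2)
  qed
  have "finite V" by (auto simp: V_def finite_PiE)
  moreover have "card V = t * M ^ D"
    by (simp add: V_def card_PiE card_cartesian_product)
  then have "card V \<le> n" using n by (simp add: M_def)
  \<comment> \<open>\<open>g\<close> relabels the abstract positions by the vertices
    \<open>{..<n}\<close>.\<close>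
  ultimately obtain g where g: "g ` V \<subseteq> {..<n}" "inj_on g V"
    using card_le_inj[of V "{..<n}"] by auto
  have \<psi>V: "\<psi> P j \<in> V" if "P \<in> X" "j < t" for P j
    using param_poly_bounds[of k P _ q j t] P_bounds[OF XX0[OF that(1)]] that k
    by (auto simp: \<psi>_def V_def M_def)
  have eq_poly: "poly (param_poly k P d) (int j) = poly (param_poly k P' d) (int j)"
    if "\<psi> P j = \<psi> P' j" "d < D" for P P' j d
    using fun_cong[OF arg_cong[OF that(1), of snd], of d] that(2) by (simp add: \<psi>_def)
  have eq_iff: "g (\<psi> P j) = g (\<psi> P' j') \<longleftrightarrow> \<psi> P j = \<psi> P' j'"
    if "P \<in> X" "P' \<in> X" "j < t" "j' < t" for P P' j j'
    using \<psi>V that g(2) by (auto dest: inj_onD)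
  have P_eqI: "P = P'" if "P \<in> X" "P' \<in> X"
    "\<And>d. d < D \<Longrightarrow> param_poly k P d = param_poly k P' d" for P P'
  proof (rule PiE_ext)
    show "P \<in> PiE ({..<D} \<times> {..<k}) (\<lambda>_. {0..<int q})" "P' \<in> PiE ({..<D} \<times> {..<k}) (\<lambda>_. {0..<int q})"
      using XX0 that unfolding X0_def by auto
    fix z assume "z \<in> {..<D} \<times> {..<k}"
    then obtain d i where z: "z = (d, i)" "d < D" "i < k" by auto
    then have "coeff (param_poly k P d) i = coeff (param_poly k P' d) i" using that(3) by simp
    then show "P z = P' z" using z by (simp add: coeff_param_poly)
  qed
  have "card X \<le> ex_copies F n G"
  proof (rule ex_copies_ge_partite_family[OF k F t G, of X "\<lambda>P j. g (\<psi> P j)"])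
    show "g (\<psi> P j) < n" if "P \<in> X" "j < t" for P j
      using g(1) \<psi>V[OF that] by auto
    show "j = j'" if "P \<in> X" "P' \<in> X" "j < t" "j' < t" "g (\<psi> P j) = g (\<psi> P' j')" for P P' j j'
      using eq_iff that by (auto simp: \<psi>_def)
  next
    fix P P' J assume P: "P \<in> X" "P' \<in> X" and J: "J \<subseteq> {..<t}" "card J = k"
      and "\<And>j. j \<in> J \<Longrightarrow> g (\<psi> P j) = g (\<psi> P' j)"
    then have agree: "\<psi> P j = \<psi> P' j" if "j \<in> J" for j using eq_iff that by blast
    show "P = P'"
    proof (rule P_eqI[OF P])
      fix d assume "d < D"
      \<comment> \<open>Interpolation with \<open>m = k\<close>: the coefficient at \<open>k\<close>
        is zero, so agreement at \<open>k\<close> points forces equality.\<close>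
      have "param_poly k P d - param_poly k P' d
          = smult (coeff (param_poly k P d - param_poly k P' d) k) (\<Prod>j\<in>J. [:- int j, 1:])"
        using J eq_poly[OF agree \<open>d < D\<close>]
        by (intro poly_with_roots) (auto simp: coeff_param_poly intro: finite_subset)
      then show "param_poly k P d = param_poly k P' d" using J by (simp add: coeff_param_poly)
    qed
  next
    fix P1 P2 P3 J a1 a2 a3
    assume P: "P1 \<in> X" "P2 \<in> X" "P3 \<in> X" and J: "J \<subseteq> {..<t}" "card J = Suc k"
      and a: "a1 \<in> J" "a2 \<in> J" "a3 \<in> J" "a1 \<noteq> a2" "a1 \<noteq> a3" "a2 \<noteq> a3"
      and g12: "\<And>j. j \<in> J - {a1, a2} \<Longrightarrow> g (\<psi> P1 j) = g (\<psi> P2 j)"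
      and g13: "\<And>j. j \<in> J - {a1, a3} \<Longrightarrow> g (\<psi> P1 j) = g (\<psi> P3 j)"
      and g23: "\<And>j. j \<in> J - {a2, a3} \<Longrightarrow> g (\<psi> P2 j) = g (\<psi> P3 j)"
    have agree12: "\<psi> P1 j = \<psi> P2 j" if "j \<in> J - {a1, a2}" for j
      using g12[OF that] eq_iff[OF P(1,2), of j j] that J by auto
    have agree13: "\<psi> P1 j = \<psi> P3 j" if "j \<in> J - {a1, a3}" for j
      using g13[OF that] eq_iff[OF P(1,3), of j j] that J by auto
    have agree23: "\<psi> P2 j = \<psi> P3 j" if "j \<in> J - {a2, a3}" for j
      using g23[OF that] eq_iff[OF P(2,3), of j j] that J by auto
    have finJ: "finite J" using J by (auto intro: finite_subset)
    \<comment> \<open>All coordinates share the factors \<open>a3 - a2\<close> and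
      \<open>a3 - a1\<close>, so the leading vectors are collinear points of one sphere.
      Distinctness of the three points gives the nondegeneracy conditions.\<close>
    have lead: "P1 (d, k - 1) = P3 (d, k - 1)" if "d < D" for d
    proof (rule proportional_chords_of_sphere[where I = "{..<D}"
          and ?l1.0 = "\<lambda>d. P1 (d, k - 1)" and ?l2.0 = "\<lambda>d. P2 (d, k - 1)"
          and ?l3.0 = "\<lambda>d. P3 (d, k - 1)" and x = "int a3 - int a2" and y = "int a3 - int a1"
          and r = "int r"])
      show "(P1 (d, k - 1) - P3 (d, k - 1)) * (int a3 - int a2)
          = (P2 (d, k - 1) - P3 (d, k - 1)) * (int a3 - int a1)" if "d \<in> {..<D}" for d
      proof -
        have "d < D" using that by simp
        show ?thesis
          using leading_coeffs_of_triangle[of "k - 1" "param_poly k P1 d" "param_poly k P2 d"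
              "param_poly k P3 d" J a1 a2 a3, OF _ _ _ finJ _ a eq_poly[OF agree12 \<open>d < D\<close>]
              eq_poly[OF agree13 \<open>d < D\<close>] eq_poly[OF agree23 \<open>d < D\<close>]] J k
          by (simp add: coeff_param_poly)
      qed
    qed (use sphere P a that in auto)
    show "P1 = P3"
    proof (rule P_eqI[OF P(1,3)])
      fix d assume "d < D"
      have card: "card (J - {a1, a3}) = k - 1" using J a by (simp add: card_Diff_subset finJ)
      \<comment> \<open>Now \<open>m = k - 1\<close>: with equal leading coefficients, the
        \<open>k - 1\<close> remaining agreements suffice.\<close>
      have "param_poly k P1 d - param_poly k P3 d
          = smult (coeff (param_poly k P1 d - param_poly k P3 d) (k - 1))
              (\<Prod>j\<in>J - {a1, a3}. [:- int j, 1:])"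
        using eq_poly[OF agree13 \<open>d < D\<close>] finJ card
        by (intro poly_with_roots) (auto simp: coeff_param_poly)
      then show "param_poly k P1 d = param_poly k P3 d"
        using lead[OF \<open>d < D\<close>] k by (simp add: coeff_param_poly)
    qed
  qed
  then have "card X * (D * q ^ 2) \<le> ex_copies F n G * (D * q ^ 2)" by (rule mult_right_mono) simp
  moreover have "q ^ (D * k) \<le> card X * (D * q ^ 2)" using r X0(2) by (simp only: X_def card_lessThan)
  ultimately show ?thesis by (simp only: mult.commute order_trans)
qed

subsection \<open>Asymptotics\<close>

text \<open>Taking \<open>g n\<close> as \<open>k\<close> minus the base-\<open>n\<close> logarithm
  of \<open>f n\<close> makes the equation exact once \<open>f n > 0\<close> and
  \<open>n > 1\<close>. The upper bound gives \<open>g n \<ge> 0\<close>, the lower bounds make it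
  arbitrarily small.\<close>

lemma power_minus_o1I:
  assumes lower: "\<And>\<delta>. \<delta> > 0 \<Longrightarrow> \<forall>\<^sub>F n in sequentially. real n powr (real k - \<delta>) \<le> real (f n)"
    and upper: "\<And>n. f n \<le> n ^ k"
  shows "power_minus_o1 f k"
proof -
  define g where "g n = real k - ln (real (f n)) / ln (real n)" for n
  have pos: "\<forall>\<^sub>F n in sequentially. f n > 0 \<and> n > 1"
    using lower[OF zero_less_one] eventually_gt_at_top[of 1]
  proof eventually_elim
    case (elim n)
    then have "0 < real n powr (real k - 1)" by simp
    then show ?case using elim by linarith
  qed
  have "g \<longlonglongrightarrow> 0"
  proof (rule tendstoI)
    fix e :: real assume "e > 0"
    then have "e / 2 > 0" by simp
    from pos lower[OF this] show "\<forall>\<^sub>F n in sequentially. dist (g n) 0 < e"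
    proof eventually_elim
      case (elim n)
      then have ln: "ln (real n) > 0" "f n > 0" by auto
      have "real (f n) \<le> real n ^ k" using upper[of n] by (metis of_nat_le_iff of_nat_power)
      then have "ln (real (f n)) \<le> real k * ln (real n)"
        using elim by (subst ln_realpow[symmetric]) auto
      then have "g n \<ge> 0" using ln by (simp add: g_def field_simps)
      have "ln (real n powr (real k - e / 2)) \<le> ln (real (f n))"
        using elim by (subst ln_le_cancel_iff) auto
      then have "(real k - e / 2) * ln (real n) \<le> ln (real (f n))"
        using elim by (simp add: ln_powr)
      then have "g n \<le> e / 2" using ln by (simp add: g_def field_simps)
      then show ?case using \<open>g n \<ge> 0\<close> \<open>e > 0\<close> by simp
    qed
  qed
  moreover have "\<forall>\<^sub>F n in sequentially. real (f n) = real n powr (real k - g n)"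
    using pos
  proof eventually_elim
    case (elim n)
    then show ?case by (simp add: g_def powr_def)
  qed
  ultimately show ?thesis unfolding power_minus_o1_def by blast
qed

lemma filterlim_nat_powr_at_top:
  fixes a :: real
  assumes "a > 0"
  shows "filterlim (\<lambda>n. real n powr a) at_top sequentially"
proof -
  have "filterlim (\<lambda>n. exp (a * ln (real n))) at_top sequentially"
    using assms
    by (intro filterlim_compose[OF exp_at_top] filterlim_tendsto_pos_mult_at_top[OF tendsto_const]
        filterlim_compose[OF ln_at_top filterlim_real_sequentially]) auto
  moreover have "\<forall>\<^sub>F n in sequentially. exp (a * ln (real n)) = real n powr a"
    using eventually_gt_at_top[of 0] by eventually_elim (simp add: powr_def)
  ultimately show ?thesis by (simp add: filterlim_cong)
qed

text \<open>For fixed \<open>D\<close>, the largest admissible \<open>q\<close> has order n^(1/D),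
  so \<open>f n\<close> is at least a constant times n^(k - 2/D). Choosing \<open>D\<close> above
  2/\<delta> leaves a positive power of \<open>n\<close> to absorb the constant.\<close>

lemma eventually_powr_le_of_construction:
  fixes t K k :: nat and f :: "nat \<Rightarrow> nat"
  assumes pos: "t > 0" "K > 0" "k \<ge> 2"
    and constr: "\<And>D q n. D > 0 \<Longrightarrow> q > 0 \<Longrightarrow> t * (K * q) ^ D \<le> n \<Longrightarrow> q ^ (D * k) \<le> D * q ^ 2 * f n"
    and "\<delta> > 0"
  shows "\<forall>\<^sub>F n in sequentially. real n powr (real k - \<delta>) \<le> real (f n)"
proof -
  obtain D :: nat where D: "2 / \<delta> < real D" using reals_Archimedean2 by blast
  have "2 / \<delta> > 0" using \<open>\<delta> > 0\<close> by simp
  then have "D > 0" using D by (cases D) auto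
  have \<delta>: "\<delta> - 2 / real D > 0" using D \<open>D > 0\<close> \<open>\<delta> > 0\<close> by (simp add: field_simps)
  \<comment> \<open>Chosen so that \<open>y n\<close> solves t (K y)^D = n exactly.\<close>
  define b where "b = (1 / real t) powr (1 / real D) / real K"
  have "b > 0" using pos by (simp add: b_def)
  define y where "y n = b * real n powr (1 / real D)" for n :: nat
  \<comment> \<open>The exponent of \<open>q\<close> left after cancelling \<open>q ^ 2\<close>; the
    subtraction does not truncate, as \<open>D * k \<ge> 2\<close>.\<close>
  define m where "m = D * k - 2"
  have Dk: "D * k = m + 2" using \<open>D > 0\<close> \<open>k \<ge> 2\<close> mult_le_mono[of 1 D 2 k] by (simp add: m_def)
  define B where "B = (b / 2) ^ m / real D"
  have "B > 0" using \<open>b > 0\<close> \<open>D > 0\<close> by (simp add: B_def)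
  have y_top: "filterlim y at_top sequentially"
    unfolding y_def using \<open>b > 0\<close> \<open>D > 0\<close>
    by (intro filterlim_tendsto_pos_mult_at_top[OF tendsto_const] filterlim_nat_powr_at_top) auto
  have "filterlim (\<lambda>n. B * real n powr (\<delta> - 2 / real D)) at_top sequentially"
    using \<open>B > 0\<close> \<delta>
    by (intro filterlim_tendsto_pos_mult_at_top[OF tendsto_const] filterlim_nat_powr_at_top) auto
  then have "\<forall>\<^sub>F n in sequentially. 1 \<le> B * real n powr (\<delta> - 2 / real D)"
    by (simp add: filterlim_at_top)
  moreover have "\<forall>\<^sub>F n in sequentially. 2 \<le> y n"
    using y_top by (simp add: filterlim_at_top)
  ultimately show ?thesis
    using eventually_gt_at_top[of 0]
  proof eventually_elim
    case (elim n)
    define q where "q = nat \<lfloor>y n\<rfloor>"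
    \<comment> \<open>As \<open>y n \<ge> 2\<close>, rounding down loses at most a factor 2, which
      is the 2 in \<open>B\<close>.\<close>
    have q: "real q \<le> y n" "y n / 2 \<le> real q" "q > 0" using elim by (auto simp: q_def) linarith+
    have Ky: "real K * y n = (real n / real t) powr (1 / real D)"
      using pos by (simp add: y_def b_def powr_divide)
    have "real (t * (K * q) ^ D) \<le> real t * (real K * y n) ^ D"
      using q by (auto intro!: mult_left_mono power_mono)
    also have "(real K * y n) ^ D = real n / real t"
      unfolding Ky using pos elim \<open>D > 0\<close> by (simp add: powr_realpow[symmetric] powr_powr)
    also have "real t * (real n / real t) = real n" using pos by simp
    finally have "t * (K * q) ^ D \<le> n" by (simp only: of_nat_le_iff)
    from constr[OF \<open>D > 0\<close> \<open>q > 0\<close> this] have "q ^ 2 * q ^ m \<le> q ^ 2 * (D * f n)"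
      unfolding Dk power_add by (simp only: mult_ac)
    then have "q ^ m \<le> D * f n" by (rule mult_left_le_imp_le) (use \<open>q > 0\<close> in simp)
    then have "real q ^ m \<le> real D * real (f n)" by (metis of_nat_le_iff of_nat_mult of_nat_power)
    moreover have "(y n / 2) ^ m \<le> real q ^ m" using q elim by (intro power_mono) auto
    ultimately have "(y n / 2) ^ m \<le> real (f n) * real D" by (simp only: mult.commute order_trans)
    then have le: "(y n / 2) ^ m / real D \<le> real (f n)"
      using \<open>D > 0\<close> by (simp only: pos_divide_le_eq of_nat_0_less_iff)
    have "real D * real k = real m + 2" using Dk by (metis of_nat_add of_nat_mult of_nat_numeral)
    then have "real m / real D = real k - 2 / real D" using \<open>D > 0\<close> by (simp add: field_simps)
    then have "(real n powr (1 / real D)) ^ m = real n powr (real k - 2 / real D)"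
      using elim by (simp add: powr_realpow[symmetric] powr_powr)
    moreover have "(y n / 2) ^ m / real D = B * (real n powr (1 / real D)) ^ m"
      by (simp add: y_def B_def power_mult_distrib power_divide)
    ultimately have "(y n / 2) ^ m / real D = B * real n powr (real k - 2 / real D)" by simp
    also have "\<dots> = (B * real n powr (\<delta> - 2 / real D)) * real n powr (real k - \<delta>)"
      using elim by (simp add: powr_add[symmetric])
    also have "\<dots> \<ge> 1 * real n powr (real k - \<delta>)"
      using elim by (intro mult_right_mono) auto
    finally show ?case using le by simp
  qed
qed

lemma ex_copies_power_minus_o1:
  assumes k: "k \<ge> 2" and F: "uniform k F"
    and T: "subhypergraph T G" "tight_triangle k T" and hom: "homomorphism \<phi> G F"
  shows "power_minus_o1 (\<lambda>n. ex_copies F n G) k"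
proof -
  have "edges T \<noteq> {}" using T by (auto simp: tight_triangle_def)
  then have G: "edges G \<noteq> {}" using T by (auto simp: subhypergraph_def)
  \<comment> \<open>The homomorphism carries an edge of \<open>G\<close> to an edge of
    \<open>F\<close>.\<close>
  then have F_ne: "edges F \<noteq> {}" using hom by (auto simp: homomorphism_def)
  then obtain e where "e \<subseteq> verts F" "card e = k" using F by (auto simp: uniform_def)
  moreover have "finite (verts F)" using F by (simp add: uniform_def)
  ultimately have t: "card (verts F) > 0" using k by (metis card_mono le_trans not_gr_zero not_numeral_le_zero)
  show ?thesis
  proof (rule power_minus_o1I)
    fix \<delta> :: real assume "\<delta> > 0"
    show "\<forall>\<^sub>F n in sequentially. real n powr (real k - \<delta>) \<le> real (ex_copies F n G)"
      by (rule eventually_powr_le_of_construction[OF t _ k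
            ex_copies_polynomial_construction[OF k F F_ne refl T] \<open>\<delta> > 0\<close>])
        (use t k in auto)
  qed (rule ex_copies_le[OF F F_ne G])
qed

section \<open>Complete hypergraphs and the conclusion\<close>

lemma uniform_complete_hypergraph: "uniform k (complete_hypergraph k t)"
  by (auto simp: uniform_def complete_hypergraph_def)

lemma complete_hypergraph_contains_tight_triangle:
  assumes "k \<ge> 2" "r > k"
  shows "\<exists>T. subhypergraph T (complete_hypergraph k r) \<and> tight_triangle k T"
proof -
  \<comment> \<open>Three distinct points can be left out because \<open>k \<ge> 2\<close>; the
    \<open>k + 1\<close> vertices fit because \<open>r > k\<close>.\<close>
  let ?T = "Hypergraph {..k} {{..k} - {0}, {..k} - {1}, {..k} - {2}}"
  have "card {{..k} - {0}, {..k} - {1}, {..k} - {2}} = 3"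
  proof -
    have "0 \<in> {..k}" "1 \<in> {..k}" "2 \<in> {..k}" using assms by auto
    then have "{..k} - {0} \<noteq> {..k} - {1}" "{..k} - {0} \<noteq> {..k} - {2}" "{..k} - {1} \<noteq> {..k} - {2}"
      by fastforce+
    then show ?thesis by (simp add: card_3_iff)
  qed
  then have "tight_triangle k ?T"
    using assms by (auto simp: tight_triangle_def uniform_def)
  moreover have "subhypergraph ?T (complete_hypergraph k r)"
    using assms by (auto simp: subhypergraph_def complete_hypergraph_def)
  ultimately show ?thesis by blast
qed

lemma homomorphism_complete_hypergraph:
  assumes "r \<le> t"
  shows "homomorphism id (complete_hypergraph k r) (complete_hypergraph k t)"
  using assms by (auto simp: homomorphism_def complete_hypergraph_def)

theorem theorem1p11:
  fixes k :: nat
  assumes "k \<ge> 2"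
  shows "(\<forall>(G :: 'a hypergraph) (F :: 'b hypergraph).
            uniform k G \<and> uniform k F \<and>
            (\<exists>T. subhypergraph T G \<and> tight_triangle k T) \<and>
            (\<exists>\<phi>. homomorphism \<phi> G F) \<longrightarrow>
            power_minus_o1 (\<lambda>n. ex_copies F n G) k) \<and>
         (\<forall>t r. t \<ge> r \<and> r > k \<longrightarrow>
            power_minus_o1
              (\<lambda>n. ex_copies (complete_hypergraph k t) n (complete_hypergraph k r)) k)"
proof (intro conjI allI impI)
  fix G :: "'a hypergraph" and F :: "'b hypergraph"
  assume "uniform k G \<and> uniform k F \<and> (\<exists>T. subhypergraph T G \<and> tight_triangle k T) \<and>
    (\<exists>\<phi>. homomorphism \<phi> G F)"
  then show "power_minus_o1 (\<lambda>n. ex_copies F n G) k"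
    using ex_copies_power_minus_o1[OF assms] by blast
next
  fix t r assume "t \<ge> r \<and> r > k"
  then show "power_minus_o1
      (\<lambda>n. ex_copies (complete_hypergraph k t) n (complete_hypergraph k r)) k"
    using ex_copies_power_minus_o1[OF assms uniform_complete_hypergraph]
      complete_hypergraph_contains_tight_triangle[OF assms] homomorphism_complete_hypergraph
    by blast
qed

end
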